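(* Let $k\ge 2$ and $1\le d\le k-1$ be integers, and put $t=k-d$. Then \[ h_d(k,n) \ge \Bigg( 1 - \binom t{ \lfloor t/2 \rfloor} \frac{ \lceil t/2\rceil^{\lceil t/2\rceil} (\lfloor t/2 \rfloor+1) ^{\lfloor t/2 \rfloor}}{(t+1)^t} +o(1) \Bigg) \binom nt, \] where $o(1)$ denotes a quantity tending to $0$ as $n\to\infty$.
   Context: A $k$-uniform hypergraph ($k$-graph) $H$ consists of a vertex set $V$ and an edge set $E\subseteq\binom{V}{k}$. For a set $S$ of $d$ vertices ($1\le d\le k-1$), $\deg_H(S)$ is the number of edges containing $S$, and the minimum $d$-degree $\delta_d(H)$ is the minimum of $\deg_H(S)$ over all $d$-vertex sets $S$. For $1\le \ell\le k-1$, a $k$-graph is an $\ell$-cycle if its vertices can be ordered cyclically so that each edge consists of $k$ consecutive vertices and every two consecutive edges (in the natural order of the edges) share exactly $\ell$ vertices. A Hamilton $\ell$-cycle of $H$ is a spanning subhypergraph that is an $\ell$-cycle. For $n$ divisible by $k-\ell$, $h_d^\ell(k,n)$ is the smallest integer $h$ such that every $n$-vertex $k$-graph $H$ with $\delta_d(H)\ge h$ contains a Hamilton $\ell$-cycle; $h_d(k,n)$ denotes $h_d^{k-1}(k,n)$ (the tight Hamilton cycle threshold). *)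

theory Defs
  imports Complex_Main "HOL-Library.Ramsey"
begin

definition kgraph :: "nat \<Rightarrow> 'a set \<Rightarrow> 'a set set \<Rightarrow> bool" where
  "kgraph k V E \<longleftrightarrow> finite V \<and> E \<subseteq> nsets V k"

definition deg :: "'a set set \<Rightarrow> 'a set \<Rightarrow> nat" where
  "deg E S = card {e \<in> E. S \<subseteq> e}"

definition min_degree :: "nat \<Rightarrow> 'a set \<Rightarrow> 'a set set \<Rightarrow> nat" where
  "min_degree d V E = Min (deg E ` nsets V d)"

text \<open>The \<open>k\<close> vertices that are consecutive from position \<open>p\<close> on in the cyclic order
  \<open>v 0, \<dots>, v (n - 1)\<close>.\<close>

definition window :: "nat \<Rightarrow> nat \<Rightarrow> (nat \<Rightarrow> 'a) \<Rightarrow> nat \<Rightarrow> 'a set" where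
  "window k n v p = (\<lambda>j. v ((p + j) mod n)) ` {..<k}"

text \<open>The edges of an \<open>\<ell>\<close>-cycle, in their natural order, start \<open>k - \<ell>\<close> positions apart and go once
  around the cyclic order of the vertices. Fixing the starting positions rules out, for instance,
  two overlapping edges together with isolated vertices. The intersection condition rules out
  degenerate cases in which the windows meet in further vertices because there are too few
  vertices.\<close>

definition ell_cycle :: "nat \<Rightarrow> nat \<Rightarrow> 'a set \<Rightarrow> 'a set set \<Rightarrow> bool" where
  "ell_cycle k l V C \<longleftrightarrow> kgraph k V C \<and>
     (\<exists>v m. bij_betw v {..<card V} V \<and> 0 < m \<and> m * (k - l) = card V \<and>
        C = (\<lambda>i. window k (card V) v (i * (k - l))) ` {..<m} \<and>
        (\<forall>i<m. card (window k (card V) v (i * (k - l)) \<inter>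
                     window k (card V) v ((Suc i mod m) * (k - l))) = l))"

definition has_hamilton_cycle :: "nat \<Rightarrow> nat \<Rightarrow> 'a set \<Rightarrow> 'a set set \<Rightarrow> bool" where
  "has_hamilton_cycle k l V E \<longleftrightarrow> (\<exists>C\<subseteq>E. ell_cycle k l V C)"

text \<open>The property is invariant under isomorphism, so vertices may be taken to be natural numbers.
  For \<open>n \<ge> d\<close> a sufficiently large \<open>h\<close> exceeds every minimum degree; hence the least \<open>h\<close> exists.\<close>

definition hamilton_threshold :: "nat \<Rightarrow> nat \<Rightarrow> nat \<Rightarrow> nat \<Rightarrow> nat" where
  "hamilton_threshold d l k n =
     (LEAST h. \<forall>(V :: nat set) E. kgraph k V E \<and> card V = n \<and> h \<le> min_degree d V E
        \<longrightarrow> has_hamilton_cycle k l V E)"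

abbreviation tight_hamilton_threshold :: "nat \<Rightarrow> nat \<Rightarrow> nat \<Rightarrow> nat" where
  "tight_hamilton_threshold d k n \<equiv> hamilton_threshold d (k - 1) k n"

end

theory Submission
  imports Defs
begin

text \<open>
  Split the vertex set into \<open>A\<close> and its complement with \<open>|A| \<approx> x n\<close>, put \<open>j = \<lfloor>k |A| / n\<rfloor>\<close>, and take as
  edges all \<open>k\<close>-sets that do not meet \<open>A\<close> in exactly \<open>j\<close> vertices. Along a tight cycle the size of
  the intersection with \<open>A\<close> changes by at most one from an edge to the next, so it stays below \<open>j\<close> or
  stays above \<open>j\<close>; but on a Hamilton cycle its average is \<open>k |A| / n\<close>, which lies in \<open>[j, j + 1)\<close>.
  The proportion of \<open>t\<close>-sets that fail to complete a given \<open>d\<close>-set to an edge is asymptotically at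
  most the largest point probability of the binomial distribution with parameters \<open>t\<close> and \<open>x\<close>. The
  choice \<open>x = \<lceil>t/2\<rceil> / (t + 1)\<close>, for which \<open>\<lceil>t/2\<rceil>\<close> and \<open>\<lceil>t/2\<rceil> - 1\<close> are both modes, gives the bound.
\<close>

section \<open>Intersection sizes along a tight cycle\<close>

lemma sum_rotate_mod:
  fixes g :: "nat \<Rightarrow> 'b :: comm_monoid_add"
  assumes "0 < n"
  shows "(\<Sum>p<n. g ((p + q) mod n)) = (\<Sum>p<n. g p)"
proof -
  have inj: "inj_on (\<lambda>p. (p + q) mod n) {..<n}"
  proof (rule inj_onI)
    fix x y assume x: "x \<in> {..<n}" and y: "y \<in> {..<n}" and "(x + q) mod n = (y + q) mod n"
    then have "int n dvd int x - int y"
      by (metis add_diff_cancel_right mod_eq_dvd_iff of_nat_add of_nat_mod)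
    moreover have "\<bar>int x - int y\<bar> < int n"
      using x y by auto
    ultimately show "x = y"
      using dvd_imp_le_int[of "int x - int y" "int n"] by fastforce
  qed
  have "(\<lambda>p. (p + q) mod n) ` {..<n} = {..<n}"
    using assms by (intro endo_inj_surj inj) auto
  then show ?thesis
    using sum.reindex[OF inj, of g] by (simp add: o_def)
qed

text \<open>The hypothesis makes the \<open>k\<close> positions of the window carry distinct
  vertices, so counting positions is the same as counting vertices. The sum over positions is the
  form suited to sliding the window and to double counting.\<close>

lemma card_window_Int:
  assumes "card (window k n v p) = k"
  shows "card (window k n v p \<inter> A) = (\<Sum>q<k. of_bool (v ((p + q) mod n) \<in> A))"
proof -
  let ?f = "\<lambda>q. v ((p + q) mod n)"
  have inj: "inj_on ?f {..<k}"
    using assms unfolding window_def by (intro eq_card_imp_inj_on) auto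
  have "window k n v p \<inter> A = ?f ` {q \<in> {..<k}. ?f q \<in> A}"
    unfolding window_def by auto
  then have "card (window k n v p \<inter> A) = card {q \<in> {..<k}. ?f q \<in> A}"
    by (simp add: card_image inj_on_subset[OF inj] subset_iff)
  also have "\<dots> = (\<Sum>q<k. of_bool (?f q \<in> A))"
    by (simp add: of_bool_def sum.If_cases Int_def)
  finally show ?thesis .
qed

text \<open>A sequence of naturals with steps of size at most one cannot pass from one side of
  \<open>j\<close> to the other without taking the value \<open>j\<close>; the side is decided at
  position 0.\<close>

lemma discrete_intermediate_value:
  fixes f :: "nat \<Rightarrow> nat"
  assumes "\<And>p. p < n \<Longrightarrow> f p \<noteq> j"
    and "\<And>p. f (Suc p) \<le> Suc (f p)" and "\<And>p. f p \<le> Suc (f (Suc p))"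
  shows "(\<forall>p<n. f p < j) \<or> (\<forall>p<n. j < f p)"
proof (cases "f 0 < j")
  case True
  have "p < n \<Longrightarrow> f p < j" for p
  proof (induction p)
    case (Suc p)
    then show ?case using assms(1)[of "Suc p"] assms(2)[of p] by simp
  qed (use True in simp)
  then show ?thesis by blast
next
  case False
  have "p < n \<Longrightarrow> j < f p" for p
  proof (induction p)
    case 0
    then show ?case using False assms(1)[of 0] by simp
  next
    case (Suc p)
    then show ?case using assms(1)[of "Suc p"] assms(3)[of p] by simp
  qed
  then show ?thesis by blast
qed

lemma no_tight_hamilton_cycle:
  assumes "1 \<le> k" and "0 < card V" and "A \<subseteq> V" and "finite V"
  shows "\<not> has_hamilton_cycle k (k - 1) V
           {e \<in> nsets V k. card (e \<inter> A) \<noteq> k * card A div card V}"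
proof
  define n where "n = card V"
  define j where "j = k * card A div n"
  assume "has_hamilton_cycle k (k - 1) V
            {e \<in> nsets V k. card (e \<inter> A) \<noteq> k * card A div card V}"
  \<comment> \<open>For \<open>l = k - 1\<close> the stride \<open>k - l\<close> is 1, so the number
    \<open>m\<close> of edges equals \<open>n\<close> and a window starts at every position.\<close>
  then obtain v where v: "bij_betw v {..<n} V"
    and w: "\<And>p. p < n \<Longrightarrow> window k n v p \<in> {e \<in> nsets V k. card (e \<inter> A) \<noteq> j}"
    using assms(1) unfolding has_hamilton_cycle_def ell_cycle_def n_def j_def by fastforce
  define g where "g p = (of_bool (v p \<in> A) :: nat)" for p
  define f where "f p = (\<Sum>q<k. g ((p + q) mod n))" for p
  have n: "0 < n" using assms n_def by simp
  have f_ne: "f p \<noteq> j" if "p < n" for p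
    using w[OF that] card_window_Int[of k n v p A] by (simp add: nsets_def f_def g_def)
  \<comment> \<open>Both sides sum \<open>g\<close> over the \<open>k + 1\<close> cyclic positions
    starting at \<open>p\<close>: moving the window by one drops the first of them and gains the
    last.\<close>
  have shift: "f (Suc p) + g (p mod n) = f p + g ((p + k) mod n)" for p
    using sum.lessThan_Suc[of "\<lambda>q. g ((p + q) mod n)" k]
      sum.lessThan_Suc_shift[of "\<lambda>q. g ((p + q) mod n)" k] by (simp add: f_def)
  have g1: "g p \<le> 1" for p
    by (simp add: g_def)
  have step: "f (Suc p) \<le> Suc (f p)" "f p \<le> Suc (f (Suc p))" for p
    using shift[of p] g1[of "p mod n"] g1[of "(p + k) mod n"] by linarith+
  \<comment> \<open>Double counting: for each offset \<open>q\<close> the positions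
    \<open>p + q\<close> run once around the cycle, so each vertex of \<open>A\<close> is counted
    \<open>k\<close> times.\<close>
  have "(\<Sum>p<n. f p) = (\<Sum>q<k. \<Sum>p<n. g ((p + q) mod n))"
    unfolding f_def by (rule sum.swap)
  also have "\<dots> = k * (\<Sum>p<n. g p)"
    using sum_rotate_mod[OF n, of g] by simp
  also have "(\<Sum>p<n. g p) = (\<Sum>x\<in>V. of_bool (x \<in> A))"
    unfolding g_def using sum.reindex_bij_betw[OF v, of "\<lambda>x. of_bool (x \<in> A) :: nat"] by simp
  also have "\<dots> = card A"
    using assms by (simp add: of_bool_def sum.If_cases Int_absorb1)
  finally have total: "(\<Sum>p<n. f p) = k * card A" .
  from discrete_intermediate_value[of n f j, OF f_ne step] show False
  proof
    assume "\<forall>p<n. f p < j"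
    then have "(\<Sum>p<n. f p) < (\<Sum>p<n. j)"
      using n by (intro sum_strict_mono) auto
    then show False
      using total times_div_less_eq_dividend[of n "k * card A"] by (simp add: j_def)
  next
    assume "\<forall>p<n. j < f p"
    then have "(\<Sum>p<n. Suc j) \<le> (\<Sum>p<n. f p)"
      by (intro sum_mono) (auto simp: Suc_le_eq)
    then show False
      using total dividend_less_times_div[OF n, of "k * card A"] by (simp add: j_def)
  qed
qed

section \<open>Minimum degree of the construction\<close>

text \<open>A value given by \<open>LEAST\<close> is usable only once some \<open>h\<close> has the
  property. The number \<open>card V choose k\<close> bounds every minimum degree, so its successor
  has the property vacuously. The bound needs a \<open>d\<close>-subset, which
  \<open>d \<le> card V\<close> provides.\<close>

lemma min_degree_less_hamilton_threshold:
  fixes V :: "nat set"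
  assumes "kgraph k V E" and "d \<le> card V" and "\<not> has_hamilton_cycle k l V E"
  shows "min_degree d V E < hamilton_threshold d l k (card V)"
proof -
  let ?P = "\<lambda>h. \<forall>(W :: nat set) F. kgraph k W F \<and> card W = card V \<and> h \<le> min_degree d W F
        \<longrightarrow> has_hamilton_cycle k l W F"
  have "min_degree d W F \<le> card V choose k"
    if "kgraph k W F" "card W = card V" for W :: "nat set" and F
  proof -
    have W: "finite W" "F \<subseteq> nsets W k" using that by (auto simp: kgraph_def)
    have "d \<le> card W" using assms(2) that(2) by simp
    then obtain S where "S \<subseteq> W" "card S = d" "finite S"
      by (rule obtain_subset_with_card_n)
    then have S: "S \<in> nsets W d" by (simp add: nsets_def)
    have "min_degree d W F \<le> deg F S"
      unfolding min_degree_def using S finite_imp_finite_nsets[OF W(1)] by (intro Min_le) auto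
    also have "\<dots> \<le> card (nsets W k)"
      unfolding deg_def using W by (intro card_mono finite_imp_finite_nsets) auto
    finally show ?thesis using that by simp
  qed
  then have "?P (Suc (card V choose k))" by fastforce
  then have "?P (hamilton_threshold d l k (card V))"
    unfolding hamilton_threshold_def by (rule LeastI)
  then have "\<not> hamilton_threshold d l k (card V) \<le> min_degree d V E"
    using assms by blast
  then show ?thesis by simp
qed

lemma card_nsets_Int_le:
  assumes "finite V" and "A \<subseteq> V"
  shows "card {T \<in> nsets V t. card (T \<inter> A) = i}
           \<le> (card A choose i) * ((card V - card A) choose (t - i))"
proof -
  let ?f = "\<lambda>T. (T \<inter> A, T - A)"
  have A: "finite A" using assms finite_subset by blast
  have "card {T \<in> nsets V t. card (T \<inter> A) = i} \<le> card (nsets A i \<times> nsets (V - A) (t - i))"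
  proof (rule card_inj_on_le)
    show "inj_on ?f {T \<in> nsets V t. card (T \<inter> A) = i}"
      by (rule inj_onI) blast
    show "?f ` {T \<in> nsets V t. card (T \<inter> A) = i} \<subseteq> nsets A i \<times> nsets (V - A) (t - i)"
      by (auto simp: nsets_def card_Diff_subset_Int)
    show "finite (nsets A i \<times> nsets (V - A) (t - i))"
      using A assms by (intro finite_cartesian_product finite_imp_finite_nsets) auto
  qed
  then show ?thesis
    using A assms by (simp add: card_cartesian_product card_Diff_subset)
qed

lemma card_nsets_superset:
  assumes "finite V" and "S \<in> nsets V d" and "d \<le> k"
  shows "card {e \<in> nsets V k. S \<subseteq> e} = (card V - d) choose (k - d)"
proof -
  have S: "S \<subseteq> V" "finite S" "card S = d" using assms by (auto simp: nsets_def)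
  have "bij_betw (\<lambda>T. T \<union> S) (nsets (V - S) (k - d)) {e \<in> nsets V k. S \<subseteq> e}"
  proof (rule bij_betw_byWitness[where f' = "\<lambda>e. e - S"])
    show "(\<lambda>T. T \<union> S) ` nsets (V - S) (k - d) \<subseteq> {e \<in> nsets V k. S \<subseteq> e}"
    proof safe
      fix T assume T: "T \<in> nsets (V - S) (k - d)"
      then have "card (T \<union> S) = (k - d) + d"
        using S by (subst card_Un_disjoint) (auto simp: nsets_def)
      then show "T \<union> S \<in> nsets V k" using T S assms by (auto simp: nsets_def)
    qed
    show "(\<lambda>e. e - S) ` {e \<in> nsets V k. S \<subseteq> e} \<subseteq> nsets (V - S) (k - d)"
      using S by (auto simp: nsets_def card_Diff_subset)
  qed (auto simp: nsets_def)
  then have "card {e \<in> nsets V k. S \<subseteq> e} = card (nsets (V - S) (k - d))"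
    by (metis bij_betw_same_card)
  then show ?thesis using S assms by (simp add: card_Diff_subset)
qed

text \<open>Removing \<open>S\<close> from a non-edge \<open>e\<close> that contains it leaves a set
  of size \<open>k - d\<close> whose intersection with \<open>A\<close> has a size determined by
  \<open>j\<close> and \<open>S\<close>. Counting such sets in all of \<open>V\<close> and asking
  for \<open>M\<close> to work for every \<open>i\<close> gives a bound that does not depend on
  \<open>S\<close>.\<close>

lemma deg_avoiding_Int_ge:
  assumes "finite V" and "A \<subseteq> V" and "S \<in> nsets V d" and "d \<le> k"
    and "\<And>i. i \<le> k - d \<Longrightarrow>
           (card A choose i) * ((card V - card A) choose (k - d - i)) \<le> M"
  shows "(card V - d) choose (k - d) \<le> deg {e \<in> nsets V k. card (e \<inter> A) \<noteq> j} S + M"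
proof -
  define t where "t = k - d"
  \<comment> \<open>If \<open>j < card (S \<inter> A)\<close>, truncated subtraction gives 0; this
    is harmless because \<open>?B\<close> is then empty.\<close>
  define i where "i = j - card (S \<inter> A)"
  let ?B = "{e \<in> nsets V k. S \<subseteq> e \<and> card (e \<inter> A) = j}"
  have S: "S \<subseteq> V" "finite S" "card S = d" using assms by (auto simp: nsets_def)
  have fin: "finite (nsets V m)" for m
    using assms(1) by (rule finite_imp_finite_nsets)
  have sub: "(\<lambda>e. e - S) ` ?B \<subseteq> {T \<in> nsets V t. card (T \<inter> A) = i}"
  proof safe
    fix e assume e: "e \<in> nsets V k" "S \<subseteq> e" "j = card (e \<inter> A)"
    then show "e - S \<in> nsets V t"
      using S by (auto simp: nsets_def card_Diff_subset t_def)
    have "(e - S) \<inter> A = e \<inter> A - S \<inter> A" by blast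
    then show "card ((e - S) \<inter> A) = i"
      using e S by (subst \<open>(e - S) \<inter> A = _\<close>, subst card_Diff_subset) (auto simp: i_def)
  qed
  have "card ?B \<le> card {T \<in> nsets V t. card (T \<inter> A) = i}"
  proof (rule card_inj_on_le[OF _ sub])
    show "inj_on (\<lambda>e. e - S) ?B" by (rule inj_onI) blast
  qed (use fin in auto)
  also have "\<dots> \<le> M"
  proof (cases "i \<le> t")
    case True
    then show ?thesis
      using card_nsets_Int_le[OF assms(1,2), of t i] assms(5)[of i] by (simp add: t_def)
  next
    case False
    have "card (T \<inter> A) \<le> t" if "T \<in> nsets V t" for T
      using that card_mono[of T "T \<inter> A"] by (auto simp: nsets_def)
    then have "{T \<in> nsets V t. card (T \<inter> A) = i} = {}" using False by blast
    then show ?thesis by (simp only: card.empty)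
  qed
  finally have B: "card ?B \<le> M" .
  let ?G = "{e \<in> {e \<in> nsets V k. card (e \<inter> A) \<noteq> j}. S \<subseteq> e}"
  have "{e \<in> nsets V k. S \<subseteq> e} = ?G \<union> ?B"
    by blast
  then have "card {e \<in> nsets V k. S \<subseteq> e} \<le> deg {e \<in> nsets V k. card (e \<inter> A) \<noteq> j} S + card ?B"
    unfolding deg_def using card_Un_le[of ?G ?B] by (simp only:)
  then show ?thesis
    using card_nsets_superset[OF assms(1,3,4)] B by linarith
qed

lemma tight_hamilton_threshold_ge:
  assumes "1 \<le> k" and "d \<le> k" and "k \<le> n" and "a \<le> n"
    and "\<And>i. i \<le> k - d \<Longrightarrow> (a choose i) * ((n - a) choose (k - d - i)) \<le> M"
  shows "(n - d) choose (k - d) \<le> tight_hamilton_threshold d k n + M"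
proof -
  let ?V = "{..<n}" and ?A = "{..<a}"
  let ?E = "{e \<in> nsets ?V k. card (e \<inter> ?A) \<noteq> k * card ?A div card ?V}"
  have "min_degree d ?V ?E \<in> deg ?E ` nsets ?V d"
  proof -
    have "{..<d} \<in> nsets ?V d" using assms by (auto simp: nsets_def)
    then show ?thesis
      unfolding min_degree_def by (intro Min_in) (auto simp: finite_imp_finite_nsets)
  qed
  then obtain S where S: "S \<in> nsets ?V d" "min_degree d ?V ?E = deg ?E S" by blast
  have "(card ?V - d) choose (k - d) \<le> deg ?E S + M"
    using assms S(1) by (intro deg_avoiding_Int_ge) auto
  moreover have "min_degree d ?V ?E < tight_hamilton_threshold d k (card ?V)"
    using assms by (intro min_degree_less_hamilton_threshold no_tight_hamilton_cycle)
      (auto simp: kgraph_def)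
  ultimately show ?thesis using S(2) by simp
qed

section \<open>The mode of a binomial distribution\<close>

text \<open>Divided by \<open>(t + 1) ^ t\<close>, these are the point probabilities of the binomial
  distribution with parameters \<open>t\<close> and \<open>c / (t + 1)\<close>. The ratio of
  consecutive ones is \<open>(t - i) * c / (Suc i * b)\<close> with \<open>b = t + 1 - c\<close>,
  which is at least 1 for \<open>i < c\<close> and at most 1 afterwards, so the weights rise up to
  \<open>c\<close> and then fall.\<close>

lemma binomial_weight_le_mode:
  fixes t c i :: nat
  assumes "c \<le> t" and "i \<le> t"
  shows "(t choose i) * c ^ i * (t + 1 - c) ^ (t - i)
           \<le> (t choose c) * c ^ c * (t + 1 - c) ^ (t - c)"
proof -
  define b where "b = t + 1 - c"
  define P where "P i = (t choose i) * c ^ i * b ^ (t - i)" for i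
  have b: "b > 0" "b + c = t + 1" using assms by (auto simp: b_def)
  have ratio: "P (Suc i) * (Suc i * b) = P i * ((t - i) * c)" if "i < t" for i
  proof -
    have "t - i = Suc (t - Suc i)" using that by simp
    then have "b ^ (t - i) = b * b ^ (t - Suc i)" by (metis power_Suc)
    moreover have "(t choose Suc i) * Suc i = (t choose i) * (t - i)"
      using binomial_absorb_comp[of t i] binomial_absorption[of i "t - 1"] that
      by (metis binomial_absorption mult.commute)
    moreover have "P (Suc i) * (Suc i * b)
        = ((t choose Suc i) * Suc i) * (c * c ^ i * (b * b ^ (t - Suc i)))"
      unfolding P_def power_Suc by (simp only: ac_simps)
    ultimately show ?thesis
      unfolding P_def by (simp only: ac_simps)
  qed
  \<comment> \<open>In subtraction-free form:
    \<open>(t - i) * c - Suc i * b = (c - Suc i) * (t + 1)\<close> over the integers, because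
    \<open>b + c = t + 1\<close>. Hence comparing \<open>Suc i\<close> with \<open>c\<close> decides
    whether the weights rise.\<close>
  have balance: "Suc i * b + c * (t + 1) = (t - i) * c + Suc i * (t + 1)" if "i < t" for i
  proof -
    have "Suc i * b + c * (Suc i + (t - i)) = (t - i) * c + Suc i * (b + c)"
      by (simp only: distrib_left ac_simps)
    moreover have "Suc i + (t - i) = t + 1" using that by simp
    ultimately show ?thesis by (simp only: b(2))
  qed
  have up: "P i \<le> P (Suc i)" if "i < c" for i
  proof -
    have "i < t" using that assms by simp
    have "Suc i * (t + 1) \<le> c * (t + 1)"
      using that by (intro mult_right_mono) auto
    then have "Suc i * b \<le> (t - i) * c"
      using balance[OF \<open>i < t\<close>] by linarith
    then have "P i * (Suc i * b) \<le> P (Suc i) * (Suc i * b)"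
      unfolding ratio[OF \<open>i < t\<close>] by (rule mult_left_mono) simp
    then show ?thesis using b by simp
  qed
  have down: "P (Suc i) \<le> P i" if "c \<le> i" "i < t" for i
  proof -
    have "c * (t + 1) \<le> Suc i * (t + 1)"
      using that by (intro mult_right_mono) auto
    then have "(t - i) * c \<le> Suc i * b"
      using balance[OF \<open>i < t\<close>] by linarith
    then have "P (Suc i) * (Suc i * b) \<le> P i * (Suc i * b)"
      unfolding ratio[OF \<open>i < t\<close>] by (rule mult_left_mono) simp
    then show ?thesis using b by simp
  qed
  have "P i \<le> P c"
  proof (cases "i \<le> c")
    case True
    then show ?thesis
      by (induction rule: inc_induct) (auto intro: le_trans[OF up])
  next
    case False
    then have "c \<le> i" by simp
    then show ?thesis using assms(2)
      by (induction rule: dec_induct) (auto intro: le_trans[OF down])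
  qed
  then show ?thesis by (simp add: P_def b_def)
qed

section \<open>Limits of ratios of binomial coefficients\<close>

text \<open>For fixed \<open>i\<close> the binomial coefficient is a product of \<open>i\<close>
  factors \<open>a n - q\<close>, over \<open>fact i\<close>. Each factor divided by
  \<open>n\<close> tends to \<open>x\<close>.\<close>

lemma tendsto_binomial_div_power:
  fixes a :: "nat \<Rightarrow> nat"
  assumes "(\<lambda>n. real (a n) / real n) \<longlonglongrightarrow> x"
  shows "(\<lambda>n. real (a n choose i) / real n ^ i) \<longlonglongrightarrow> x ^ i / fact i"
proof -
  have "(\<lambda>n. (\<Prod>q<i. (real (a n) / real n - real q / real n)) / fact i) \<longlonglongrightarrow> (\<Prod>q<i. (x - 0)) / fact i"
    by (intro tendsto_intros assms lim_const_over_n) auto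
  moreover have "(\<Prod>q<i. (real (a n) / real n - real q / real n)) / fact i
      = real (a n choose i) / real n ^ i" for n
  proof -
    have "real (a n choose i) = (\<Prod>q<i. real (a n) - real q) / fact i"
      by (simp add: binomial_gbinomial gbinomial_prod_rev atLeast0LessThan)
    moreover have "(\<Prod>q<i. (real (a n) / real n - real q / real n)) = (\<Prod>q<i. real (a n) - real q) / real n ^ i"
      by (simp add: diff_divide_distrib[symmetric] prod_dividef)
    ultimately show ?thesis by simp
  qed
  ultimately show ?thesis by simp
qed

lemma tendsto_div_linear:
  "(\<lambda>n. real (c * n div m) / real n) \<longlonglongrightarrow> real c / real m"
proof (cases "m = 0")
  case False
  have l: "(\<lambda>n. real c / real m - 1 / real n) \<longlonglongrightarrow> real c / real m - 0"
    by (intro tendsto_intros lim_const_over_n)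
  show ?thesis
  proof (rule tendsto_sandwich)
    show "\<forall>\<^sub>F n in sequentially. real c / real m - 1 / real n \<le> real (c * n div m) / real n"
      using eventually_gt_at_top[of 0]
    proof eventually_elim
      case (elim n)
      have "real (c * n) / real m - 1 \<le> real (c * n div m)"
        using floor_divide_of_nat_eq[of "c * n" m, where ?'a = real] by linarith
      then have "(real (c * n) / real m - 1) / real n \<le> real (c * n div m) / real n"
        by (rule divide_right_mono) simp
      then show ?case using elim by (simp add: diff_divide_distrib)
    qed
    show "\<forall>\<^sub>F n in sequentially. real (c * n div m) / real n \<le> real c / real m"
      using eventually_gt_at_top[of 0]
    proof eventually_elim
      case (elim n)
      have "real (c * n div m) / real n \<le> (real (c * n) / real m) / real n"
        using floor_divide_of_nat_eq[of "c * n" m, where ?'a = real]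
        by (intro divide_right_mono) (linarith, simp)
      then show ?case using elim by simp
    qed
  qed (use l in auto)
qed simp

text \<open>Sampling without replacement tends to sampling with replacement: after division by
  \<open>n ^ t\<close>, distributed as \<open>n ^ i * n ^ (t - i)\<close>, all three binomial
  coefficients have limits.\<close>

lemma tendsto_binomial_proportion:
  fixes a :: "nat \<Rightarrow> nat"
  assumes "(\<lambda>n. real (a n) / real n) \<longlonglongrightarrow> x" and "\<And>n. a n \<le> n" and "i \<le> t"
  shows "(\<lambda>n. real ((a n choose i) * ((n - a n) choose (t - i))) / real (n choose t))
           \<longlonglongrightarrow> real (t choose i) * x ^ i * (1 - x) ^ (t - i)"
proof -
  \<comment> \<open>The quotient is 0 at \<open>n = 0\<close>, so it is only eventually 1. Left
    uncancelled, it makes the subtraction below an identity for every \<open>n\<close>.\<close>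
  have one: "(\<lambda>n. real n / real n) \<longlonglongrightarrow> 1"
    by (rule tendsto_eventually) (use eventually_gt_at_top[of 0] in eventually_elim, simp)
  have "(\<lambda>n. real (n - a n) / real n) \<longlonglongrightarrow> 1 - x"
    using tendsto_diff[OF one assms(1)] assms(2)
    by (simp add: diff_divide_distrib)
  note lims = tendsto_binomial_div_power[OF assms(1), of i]
    tendsto_binomial_div_power[OF this, of "t - i"] tendsto_binomial_div_power[OF one, of t]
  have "(\<lambda>n. (real (a n choose i) / real n ^ i) * (real ((n - a n) choose (t - i)) / real n ^ (t - i))
          / (real (n choose t) / real n ^ t))
        \<longlonglongrightarrow> (x ^ i / fact i) * ((1 - x) ^ (t - i) / fact (t - i)) / (1 ^ t / fact t)"
    by (intro tendsto_intros lims) simp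
  moreover have "(x ^ i / fact i) * ((1 - x) ^ (t - i) / fact (t - i)) / (1 ^ t / fact t)
      = real (t choose i) * x ^ i * (1 - x) ^ (t - i)"
    using assms(3) by (simp add: binomial_fact)
  moreover have "\<forall>\<^sub>F n in sequentially.
      (real (a n choose i) / real n ^ i) * (real ((n - a n) choose (t - i)) / real n ^ (t - i))
          / (real (n choose t) / real n ^ t)
      = real ((a n choose i) * ((n - a n) choose (t - i))) / real (n choose t)"
    using eventually_gt_at_top[of 0]
  proof eventually_elim
    case (elim n)
    have "real n ^ t = real n ^ i * real n ^ (t - i)"
      using assms(3) by (simp flip: power_add)
    then show ?case using elim by (simp add: divide_simps)
  qed
  ultimately show ?thesis using Lim_transform_eventually by fastforce
qed

lemma tendsto_binomial_diff_proportion: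
  "(\<lambda>n. real ((n - d) choose t) / real (n choose t)) \<longlonglongrightarrow> 1"
proof -
  have one: "(\<lambda>n. real n / real n) \<longlonglongrightarrow> 1"
    by (rule tendsto_eventually) (use eventually_gt_at_top[of 0] in eventually_elim, simp)
  have "(\<lambda>n. real n / real n - real d / real n) \<longlonglongrightarrow> 1 - 0"
    by (intro tendsto_intros one lim_const_over_n)
  moreover have "\<forall>\<^sub>F n in sequentially. real n / real n - real d / real n = real (n - d) / real n"
    using eventually_ge_at_top[of d]
    by eventually_elim (simp add: diff_divide_distrib)
  ultimately have "(\<lambda>n. real (n - d) / real n) \<longlonglongrightarrow> 1"
    using Lim_transform_eventually by fastforce
  note lims = tendsto_binomial_div_power[OF this, of t] tendsto_binomial_div_power[OF one, of t]
  have "(\<lambda>n. (real ((n - d) choose t) / real n ^ t) / (real (n choose t) / real n ^ t))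
      \<longlonglongrightarrow> (1 ^ t / fact t) / (1 ^ t / fact t)"
    by (intro tendsto_intros lims) simp
  then have "(\<lambda>n. (real ((n - d) choose t) / real n ^ t) / (real (n choose t) / real n ^ t)) \<longlonglongrightarrow> 1"
    by simp
  moreover have "\<forall>\<^sub>F n in sequentially.
      (real ((n - d) choose t) / real n ^ t) / (real (n choose t) / real n ^ t)
      = real ((n - d) choose t) / real (n choose t)"
    using eventually_gt_at_top[of 0] by eventually_elim simp
  ultimately show ?thesis using Lim_transform_eventually by fastforce
qed

section \<open>The asymptotic lower bound\<close>

text \<open>The construction is used with \<open>card A\<close> about
  \<open>c * n / (t + 1)\<close>, for which the largest limiting proportion of lost
  \<open>t\<close>-sets is the weight at \<open>i = c\<close>. Every \<open>c \<le> t\<close> gives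
  a bound; the value of \<open>c\<close> is fixed only in the theorem.\<close>

lemma eventually_tight_hamilton_threshold_ge:
  fixes c d k t :: nat and e :: real
  assumes "1 \<le> k" and "d \<le> k" and "t = k - d" and "c \<le> t" and "0 < e"
  shows "\<forall>\<^sub>F n in sequentially.
    1 - real (t choose c) * real c ^ c * real (t + 1 - c) ^ (t - c) / real (t + 1) ^ t - e
      \<le> real (tight_hamilton_threshold d k n) / real (n choose t)"
proof -
  define m where "m = real (t choose c) * real c ^ c * real (t + 1 - c) ^ (t - c) / real (t + 1) ^ t"
  define x where "x = real c / real (t + 1)"
  define a where "a n = c * n div (t + 1)" for n
  have a_le: "a n \<le> n" for n
  proof -
    have "a n \<le> (t + 1) * n div (t + 1)"
      unfolding a_def using assms(4) by (intro div_le_mono mult_right_mono) auto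
    also have "\<dots> = n" by (rule nonzero_mult_div_cancel_left) simp
    finally show ?thesis .
  qed
  have p_le: "real (t choose i) * x ^ i * (1 - x) ^ (t - i) \<le> m" if "i \<le> t" for i
  proof -
    have "1 - x = real (t + 1 - c) / real (t + 1)"
      using assms(4) by (simp add: x_def field_simps)
    moreover have "real (t + 1) ^ t = real (t + 1) ^ i * real (t + 1) ^ (t - i)"
      using that by (simp flip: power_add)
    ultimately have "real (t choose i) * x ^ i * (1 - x) ^ (t - i)
        = real ((t choose i) * c ^ i * (t + 1 - c) ^ (t - i)) / real (t + 1) ^ t"
      by (simp add: x_def power_divide)
    also have "\<dots> \<le> real ((t choose c) * c ^ c * (t + 1 - c) ^ (t - c)) / real (t + 1) ^ t"
      by (intro divide_right_mono of_nat_mono binomial_weight_le_mode assms that) simp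
    finally show ?thesis by (simp add: m_def)
  qed
  have "\<forall>\<^sub>F n in sequentially.
      real ((a n choose i) * ((n - a n) choose (t - i))) / real (n choose t) < m + e / 2"
    if "i \<le> t" for i
  proof (rule order_tendstoD)
    show "(\<lambda>n. real ((a n choose i) * ((n - a n) choose (t - i))) / real (n choose t))
        \<longlonglongrightarrow> real (t choose i) * x ^ i * (1 - x) ^ (t - i)"
      using that a_le unfolding a_def x_def
      by (intro tendsto_binomial_proportion tendsto_div_linear)
    show "real (t choose i) * x ^ i * (1 - x) ^ (t - i) < m + e / 2"
      using p_le[OF that] assms(5) by simp
  qed
  then have "\<forall>\<^sub>F n in sequentially. \<forall>i\<in>{..t}.
      real ((a n choose i) * ((n - a n) choose (t - i))) / real (n choose t) < m + e / 2"
    by (intro eventually_ball_finite) auto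
  moreover have "\<forall>\<^sub>F n in sequentially. 1 - e / 2 < real ((n - d) choose t) / real (n choose t)"
    by (rule order_tendstoD[OF tendsto_binomial_diff_proportion]) (use assms(5) in simp)
  ultimately show ?thesis
    using eventually_ge_at_top[of k] unfolding m_def[symmetric]
  proof eventually_elim
    case (elim n)
    define N where "N = real (n choose t)"
    \<comment> \<open>\<open>M\<close> bounds the number of lost sets for all
      \<open>i \<le> t\<close> at once; rounding down is safe since the counts are integers.\<close>
    define M where "M = nat \<lfloor>(m + e / 2) * N\<rfloor>"
    have N: "N > 0" using elim assms by (simp add: N_def)
    have "0 \<le> m" by (simp add: m_def)
    then have M: "real M \<le> (m + e / 2) * N"
      using N assms(5) by (simp add: M_def)
    have "(a n choose i) * ((n - a n) choose (t - i)) \<le> M" if "i \<le> t" for i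
    proof -
      have "real ((a n choose i) * ((n - a n) choose (t - i))) \<le> (m + e / 2) * N"
        using elim(1) that N less_imp_le by (auto simp: N_def[symmetric] pos_divide_less_eq)
      then show ?thesis
        unfolding M_def by (simp add: le_nat_floor)
    qed
    then have "(n - d) choose t \<le> tight_hamilton_threshold d k n + M"
      unfolding assms(3) using assms(1,2) elim(3) a_le
      by (intro tight_hamilton_threshold_ge[where a = "a n"]) auto
    then have "real ((n - d) choose t) \<le> real (tight_hamilton_threshold d k n) + real M"
      by (metis of_nat_add of_nat_le_iff)
    moreover have "(1 - e / 2) * N < real ((n - d) choose t)"
      using elim(2) N by (simp add: N_def[symmetric] pos_less_divide_eq)
    \<comment> \<open>One half of \<open>e\<close> pays for the limit of the lost proportion, the
      other for replacing \<open>n - d\<close> by \<open>n\<close>.\<close>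
    ultimately have "(1 - m - e) * N \<le> real (tight_hamilton_threshold d k n)"
      using M by (simp add: algebra_simps)
    then show ?case
      using N by (simp add: N_def[symmetric] pos_le_divide_eq)
  qed
qed

theorem theorem1p4:
  fixes k d t :: nat
  assumes "2 \<le> k" and "1 \<le> d" and "d \<le> k - 1" and "t = k - d"
  shows "\<exists>\<epsilon> :: nat \<Rightarrow> real. \<epsilon> \<longlonglongrightarrow> 0 \<and>
    (\<forall>n. real (tight_hamilton_threshold d k n) \<ge>
      (1 - real (t choose nat \<lfloor>real t / 2\<rfloor>)
           * (real (nat \<lceil>real t / 2\<rceil>) ^ nat \<lceil>real t / 2\<rceil>
              * (real (nat \<lfloor>real t / 2\<rfloor>) + 1) ^ nat \<lfloor>real t / 2\<rfloor>)
           / (real t + 1) ^ t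
         + \<epsilon> n) * real (n choose t))"
proof -
  define f where "f = t div 2"
  define c where "c = t - f"
  define L where "L = 1 - real (t choose f) * (real c ^ c * (real f + 1) ^ f) / (real t + 1) ^ t"
  define h where "h n = real (tight_hamilton_threshold d k n)" for n
  \<comment> \<open>Only a lower bound on \<open>h n / real (n choose t)\<close> is available, so
    this quotient may stay well above \<open>L\<close>. Cutting off at 0 discards the excess and
    forces convergence.\<close>
  define \<epsilon> where "\<epsilon> n = min 0 (h n / real (n choose t) - L)" for n
  have f: "nat \<lfloor>real t / 2\<rfloor> = f"
    unfolding f_def by linarith
  have c: "nat \<lceil>real t / 2\<rceil> = c"
    unfolding c_def f_def by linarith
  have ct: "c \<le> t" "t - c = f" "t + 1 - c = f + 1"
    by (auto simp: c_def f_def)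
  \<comment> \<open>Symmetry turns \<open>t choose f\<close> into \<open>t choose c\<close>, and
    \<open>t + 1 - c\<close> is \<open>f + 1\<close>, so \<open>L\<close> takes the form given by
    the mode \<open>c\<close>.\<close>
  have L: "L = 1 - real (t choose c) * real c ^ c * real (t + 1 - c) ^ (t - c) / real (t + 1) ^ t"
    using binomial_symmetric[OF ct(1)] unfolding L_def ct(2,3) by (simp add: add.commute)
  have "\<epsilon> \<longlonglongrightarrow> 0"
  proof (rule order_tendstoI)
    fix y :: real assume "y < 0"
    then have "\<forall>\<^sub>F n in sequentially. L - (- y / 2) \<le> h n / real (n choose t)"
      unfolding L h_def using assms ct(1)
      by (intro eventually_tight_hamilton_threshold_ge) auto
    then show "\<forall>\<^sub>F n in sequentially. y < \<epsilon> n"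
      by eventually_elim (use \<open>y < 0\<close> in \<open>auto simp: \<epsilon>_def\<close>)
  next
    fix y :: real assume "0 < y"
    then show "\<forall>\<^sub>F n in sequentially. \<epsilon> n < y"
      by (simp add: \<epsilon>_def min_less_iff_disj)
  qed
  moreover have "(L + \<epsilon> n) * real (n choose t) \<le> h n" for n
  \<comment> \<open>For \<open>n < t\<close> the quotient in \<open>\<epsilon>\<close> is a division
    by zero, but the bound to be shown is then just \<open>0 \<le> h n\<close>.\<close>
  proof (cases "n choose t = 0")
    case True
    then show ?thesis unfolding h_def by (simp only: of_nat_0 mult_zero_right of_nat_0_le_iff)
  next
    case False
    have "L + \<epsilon> n \<le> h n / real (n choose t)"
      by (simp add: \<epsilon>_def)
    then show ?thesis using False by (simp add: pos_le_divide_eq)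
  qed
  ultimately show ?thesis
    unfolding f c L_def h_def by blast
qed

end
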